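(* Let $(\mathfrak g,[\cdot,\cdot],\alpha)$ be a Hom-Lie algebra over $\mathbb K$ and $(V,\rho,\beta)$ a representation of $\mathfrak g$. Let $\widetilde\rho:\mathfrak g\to\mathrm{End}(V^* )$ be given by $\widetilde\rho(x)=-{}^t\rho(x)$ (i.e. $\widetilde\rho(x)(f)=-f\circ\rho(x)$) and $\widetilde\beta={}^t\beta$ (i.e. $\widetilde\beta(f)=f\circ\beta$). Then the triple $(V^*,\widetilde\rho,\widetilde\beta)$ is a representation of the Hom-Lie algebra $(\mathfrak g,[\cdot,\cdot],\alpha)$ if and only if $$\beta\circ\rho([x,y])=\rho(x)\circ\rho(\alpha(y))-\rho(y)\circ\rho(\alpha(x))\qquad\text{for all }x,y\in\mathfrak g.$$
   Context: $\mathbb K$ is an algebraically closed field of characteristic $0$. A Hom-Lie algebra is a triple $(\mathfrak g,[\cdot,\cdot],\alpha)$ with $[\cdot,\cdot]$ a skew-symmetric bilinear bracket and $\alpha$ a linear map such that $[\alpha(x),[y,z]]+[\alpha(y),[z,x]]+[\alpha(z),[x,y]]=0$ for all $x,y,z$. A representation of it is a triple $(V,\rho,\beta)$ with $V$ a $\mathbb K$-vector space, $\beta\in\mathrm{End}(V)$ and $\rho:\mathfrak g\to\mathrm{End}(V)$ linear with $\rho([x,y])\circ\beta=\rho(\alpha(x))\circ\rho(y)-\rho(\alpha(y))\circ\rho(x)$ for all $x,y\in\mathfrak g$. $V^*$ is the dual vector space of $V$. *)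

theory Defs
  imports "HOL-Computational_Algebra.Polynomial" "HOL-Library.Function_Algebras"
begin

locale hom_lie_algebra = vector_space sG
  for sG :: "'k::field \<Rightarrow> 'g::ab_group_add \<Rightarrow> 'g" +
  fixes br :: "'g \<Rightarrow> 'g \<Rightarrow> 'g"
    and \<alpha> :: "'g \<Rightarrow> 'g"
  assumes bracket_linear_left: "Vector_Spaces.linear sG sG (\<lambda>x. br x y)"
    and bracket_linear_right: "Vector_Spaces.linear sG sG (br x)"
    and bracket_skew: "br x y = - br y x"
    and twist_linear: "Vector_Spaces.linear sG sG \<alpha>"
    and hom_jacobi: "br (\<alpha> x) (br y z) + br (\<alpha> y) (br z x) + br (\<alpha> z) (br x y) = 0"

text \<open>
  The dual of a vector space \<open>V\<close> over \<open>'k\<close> cannot be a type depending on the scaling of \<open>V\<close>;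
  it is a subspace of the function space \<open>'v \<Rightarrow> 'k\<close>. Representations are therefore carried by a
  subspace \<open>W\<close> of an ambient space, with \<open>W = UNIV\<close> when the ambient type is the vector space
  itself. Maps are only meaningful on \<open>W\<close>: their values outside \<open>W\<close> are ignored.
\<close>

definition endomorphism_on :: "'v set \<Rightarrow> ('k \<Rightarrow> 'v \<Rightarrow> 'v) \<Rightarrow> ('v::plus \<Rightarrow> 'v) \<Rightarrow> bool" where
  "endomorphism_on W sV T \<longleftrightarrow>
     (\<forall>v\<in>W. T v \<in> W) \<and>
     (\<forall>v\<in>W. \<forall>w\<in>W. T (v + w) = T v + T w) \<and>
     (\<forall>c. \<forall>v\<in>W. T (sV c v) = sV c (T v))"

locale hom_lie_representation =
  hom_lie_algebra sG br \<alpha> + V: vector_space sV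
  for sG :: "'k::field \<Rightarrow> 'g::ab_group_add \<Rightarrow> 'g"
    and br :: "'g \<Rightarrow> 'g \<Rightarrow> 'g"
    and \<alpha> :: "'g \<Rightarrow> 'g"
    and sV :: "'k \<Rightarrow> 'v::ab_group_add \<Rightarrow> 'v" +
  fixes W :: "'v set"
    and \<rho> :: "'g \<Rightarrow> 'v \<Rightarrow> 'v"
    and \<beta> :: "'v \<Rightarrow> 'v"
  assumes carrier_subspace: "V.subspace W"
    and beta_endomorphism: "endomorphism_on W sV \<beta>"
    and rho_endomorphism: "endomorphism_on W sV (\<rho> x)"
    and rho_add: "v \<in> W \<Longrightarrow> \<rho> (x + y) v = \<rho> x v + \<rho> y v"
    and rho_scale: "v \<in> W \<Longrightarrow> \<rho> (sG c x) v = sV c (\<rho> x v)"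
    and rho_bracket: "v \<in> W \<Longrightarrow>
      (\<rho> (br x y) \<circ> \<beta>) v = (\<rho> (\<alpha> x) \<circ> \<rho> y) v - (\<rho> (\<alpha> y) \<circ> \<rho> x) v"

definition dual_space :: "('k::field \<Rightarrow> 'v::ab_group_add \<Rightarrow> 'v) \<Rightarrow> ('v \<Rightarrow> 'k) set" where
  "dual_space sV = {f. Vector_Spaces.linear sV (*) f}"

definition dual_scale :: "'k::times \<Rightarrow> ('v \<Rightarrow> 'k) \<Rightarrow> 'v \<Rightarrow> 'k" where
  "dual_scale c f = (\<lambda>v. c * f v)"

definition dual_map :: "('v \<Rightarrow> 'v) \<Rightarrow> ('v \<Rightarrow> 'k) \<Rightarrow> 'v \<Rightarrow> 'k" where
  "dual_map T f = f \<circ> T"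

definition dual_rep :: "('g \<Rightarrow> 'v \<Rightarrow> 'v) \<Rightarrow> 'g \<Rightarrow> ('v \<Rightarrow> 'k::uminus) \<Rightarrow> 'v \<Rightarrow> 'k" where
  "dual_rep \<rho> x f = - dual_map (\<rho> x) f"

end

theory Submission
  imports Defs
begin

text \<open>
  Evaluated at a functional \<open>f\<close>, the representation identity of the dual triple is \<open>f\<close> applied to
  the stated condition, so the equivalence holds because linear functionals separate the points of
  a vector space; all other representation axioms of the dual triple hold unconditionally.
\<close>

lemma vector_space_mult: "vector_space ((*) :: 'k::field \<Rightarrow> 'k \<Rightarrow> 'k)"
  by unfold_locales (auto simp: algebra_simps)

lemma vector_space_dual_scale: "vector_space (dual_scale :: 'k::field \<Rightarrow> ('v \<Rightarrow> 'k) \<Rightarrow> 'v \<Rightarrow> 'k)"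
  by unfold_locales (auto simp: dual_scale_def fun_eq_iff algebra_simps)

text \<open>\<open>Vector_Spaces.linear\<close> also bundles the vector space axioms of source and
  target. Those of \<open>sV\<close> are assumed and those of the field hold by its arithmetic, so
  only two equations remain.\<close>

lemma dual_space_iff:
  assumes "vector_space sV"
  shows "f \<in> dual_space sV \<longleftrightarrow> (\<forall>v w. f (v + w) = f v + f w) \<and> (\<forall>c v. f (sV c v) = c * f v)"
  using assms
  by (auto simp: dual_space_def Vector_Spaces.linear_def module_hom_def module_hom_axioms_def
      vector_space_def module_def algebra_simps)

lemma subspace_dual_space:
  assumes "vector_space (sV :: 'k::field \<Rightarrow> 'v::ab_group_add \<Rightarrow> 'v)"
  shows "module.subspace dual_scale (dual_space sV)"
proof -
  interpret D: vector_space "dual_scale :: 'k \<Rightarrow> ('v \<Rightarrow> 'k) \<Rightarrow> 'v \<Rightarrow> 'k"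
    by (rule vector_space_dual_scale)
  show ?thesis
    by (rule D.subspaceI) (auto simp: dual_space_iff[OF assms] dual_scale_def algebra_simps)
qed

text \<open>If the vectors differ, their difference is nonzero, and some functional takes the value
  1 on it.\<close>

lemma dual_space_separates_points:
  assumes "vector_space (sV :: 'k::field \<Rightarrow> 'v::ab_group_add \<Rightarrow> 'v)"
    and eq: "\<And>f. f \<in> dual_space sV \<Longrightarrow> f v = f w"
  shows "v = w"
proof (rule ccontr)
  assume "v \<noteq> w"
  interpret P: vector_space_pair sV "(*) :: 'k \<Rightarrow> 'k \<Rightarrow> 'k"
    using assms(1) vector_space_mult by (rule vector_space_pair.intro)
  \<comment> \<open>A nonzero vector forms an independent set, so a value prescribed on it extends
    to a linear functional on the whole space, in any dimension.\<close>
  have "P.vs1.independent {v - w}"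
    using \<open>v \<noteq> w\<close> by simp
  then obtain f where f: "Vector_Spaces.linear sV (*) f" "f (v - w) = 1"
    using P.linear_independent_extend[of "{v - w}" "\<lambda>_. 1"] by auto
  then have "f v - f w = 1"
    using P.linear_diff by metis
  with eq[of f] f(1) show False
    by (simp add: dual_space_def)
qed

text \<open>Linearity of \<open>T\<close> keeps \<open>f \<circ> T\<close> in the dual space;
  linearity in \<open>f\<close> is a pointwise computation.\<close>

lemma endomorphism_on_dual_map:
  assumes "vector_space sV" and "endomorphism_on UNIV sV T"
  shows "endomorphism_on (dual_space sV) dual_scale (dual_map T)"
  using assms(2)
  by (auto simp: endomorphism_on_def dual_space_iff[OF assms(1)] dual_map_def dual_scale_def fun_eq_iff)

lemma endomorphism_on_dual_rep:
  assumes "vector_space sV" and "endomorphism_on UNIV sV (\<rho> x)"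
  shows "endomorphism_on (dual_space sV) dual_scale (dual_rep \<rho> x)"
  using assms(2)
  by (auto simp: endomorphism_on_def dual_space_iff[OF assms(1)] dual_map_def dual_rep_def
      dual_scale_def fun_eq_iff)

text \<open>Transposition reverses composition, so
  \<open>dual_rep \<rho> x' \<circ> dual_rep \<rho> y\<close> sends \<open>f\<close> to
  \<open>f \<circ> \<rho> y \<circ> \<rho> x'\<close>, the two signs cancelling. The intended values
  of \<open>z\<close>, \<open>x'\<close>, \<open>y'\<close> are \<open>br x y\<close>,
  \<open>\<alpha> x\<close>, \<open>\<alpha> y\<close>.\<close>

lemma dual_rep_bracket_iff:
  assumes "vector_space (sV :: 'k::field \<Rightarrow> 'v::ab_group_add \<Rightarrow> 'v)"
  shows "(\<forall>f\<in>dual_space sV. (dual_rep \<rho> z \<circ> dual_map \<beta>) f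
            = (dual_rep \<rho> x' \<circ> dual_rep \<rho> y) f - (dual_rep \<rho> y' \<circ> dual_rep \<rho> x) f)
     \<longleftrightarrow> \<beta> \<circ> \<rho> z = (\<rho> x \<circ> \<rho> y') - (\<rho> y \<circ> \<rho> x')" (is "?L \<longleftrightarrow> ?R")
proof -
  have diff: "f (u - w) = f u - f w" if "f \<in> dual_space sV" for f u w
    using that unfolding dual_space_iff[OF assms] by (metis add_diff_cancel diff_add_cancel)
  \<comment> \<open>The bracket side keeps a single minus sign; moving it across swaps the two
    products on the other side.\<close>
  have neg: "- a = b - c \<longleftrightarrow> a = c - b" for a b c :: 'k
    by (metis minus_diff_eq minus_minus)
  have "?L \<longleftrightarrow> (\<forall>f\<in>dual_space sV. \<forall>v. f (\<beta> (\<rho> z v)) = f (\<rho> x (\<rho> y' v) - \<rho> y (\<rho> x' v)))"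
    by (simp add: dual_rep_def dual_map_def fun_eq_iff diff neg)
  \<comment> \<open>Separation of points is applied for each fixed \<open>v\<close>, with
    \<open>f\<close> ranging over all functionals.\<close>
  also have "\<dots> \<longleftrightarrow> (\<forall>v. \<beta> (\<rho> z v) = \<rho> x (\<rho> y' v) - \<rho> y (\<rho> x' v))"
    using dual_space_separates_points[OF assms] by metis
  also have "\<dots> \<longleftrightarrow> ?R"
    by (simp add: fun_eq_iff)
  finally show ?thesis .
qed

theorem proposition2p5:
  fixes sG :: "'k::{alg_closed_field, field_char_0} \<Rightarrow> 'g::ab_group_add \<Rightarrow> 'g"
    and br :: "'g \<Rightarrow> 'g \<Rightarrow> 'g"
    and \<alpha> :: "'g \<Rightarrow> 'g"
    and sV :: "'k \<Rightarrow> 'v::ab_group_add \<Rightarrow> 'v"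
    and \<rho> :: "'g \<Rightarrow> 'v \<Rightarrow> 'v"
    and \<beta> :: "'v \<Rightarrow> 'v"
  assumes "hom_lie_algebra sG br \<alpha>"
    and "hom_lie_representation sG br \<alpha> sV UNIV \<rho> \<beta>"
  shows "hom_lie_representation sG br \<alpha> dual_scale (dual_space sV) (dual_rep \<rho>) (dual_map \<beta>) \<longleftrightarrow>
    (\<forall>x y. \<beta> \<circ> \<rho> (br x y) = (\<rho> x \<circ> \<rho> (\<alpha> y)) - (\<rho> y \<circ> \<rho> (\<alpha> x)))"
proof -
  interpret R: hom_lie_representation sG br \<alpha> sV UNIV \<rho> \<beta>
    by (rule assms(2))
  have V: "vector_space sV"
    by (rule R.V.vector_space_axioms)
  have add: "dual_rep \<rho> (x + y) f = dual_rep \<rho> x f + dual_rep \<rho> y f"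
    if "f \<in> dual_space sV" for x y f
    using that by (simp add: dual_rep_def dual_map_def fun_eq_iff dual_space_iff[OF V] R.rho_add)
  have scale: "dual_rep \<rho> (sG c x) f = dual_scale c (dual_rep \<rho> x f)"
    if "f \<in> dual_space sV" for c x f
    using that
    by (simp add: dual_rep_def dual_map_def dual_scale_def fun_eq_iff dual_space_iff[OF V] R.rho_scale)
  have endo: "endomorphism_on (dual_space sV) dual_scale (dual_rep \<rho> x)" for x
    by (rule endomorphism_on_dual_rep[OF V R.rho_endomorphism])
  \<comment> \<open>Once the locale predicate is unfolded, every conjunct except the bracket
    identity is one of the facts supplied.\<close>
  have "hom_lie_representation sG br \<alpha> dual_scale (dual_space sV) (dual_rep \<rho>) (dual_map \<beta>) \<longleftrightarrow>
      (\<forall>x y. \<forall>f\<in>dual_space sV. (dual_rep \<rho> (br x y) \<circ> dual_map \<beta>) f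
         = (dual_rep \<rho> (\<alpha> x) \<circ> dual_rep \<rho> y) f - (dual_rep \<rho> (\<alpha> y) \<circ> dual_rep \<rho> x) f)"
    unfolding hom_lie_representation_def hom_lie_representation_axioms_def
    using assms(1) vector_space_dual_scale subspace_dual_space[OF V]
      endomorphism_on_dual_map[OF V R.beta_endomorphism] endo add scale
    by blast
  then show ?thesis
    by (simp only: dual_rep_bracket_iff[OF V])
qed

end
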